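(* Assume that $(H_1)$, $(H_1^{\mathcal A})$ and $(H_2^{\mathcal A})$ (as stated in the context) hold, with activation functions $g_i$ of class $\mathcal A$. Then for each $\Sigma=(\varsigma_1,\dots,\varsigma_N)\in\{1,2\}^N$ the set $\mathcal K^\Sigma$ is positively invariant for the solution flow of the network (GNN): for every $\phi\in\mathcal K^\Sigma$ one has $u_t(\cdot;\phi)\in\mathcal K^\Sigma$ for all $t\ge 0$.
   Context: **System.** Let $N,M\ge1$ be integers; indices satisfy $i,j\in\{1,\dots,N\}$, $l\in\{1,\dots,M\}$. The general neural network (GNN) is $$\frac{du^i(t)}{dt}=-c_i(t)u^i(t)+\sum_{l=1}^M\sum_{j=1}^N a_{ijl}(t)\,g_j\big(\sigma_j u^j(t-\kappa_{ijl}(t))\big)+J_i(t),\qquad i=1,\dots,N. \tag{GNN}$$ The delays satisfy $0<\kappa_{ijl}(t)\le\kappa_{ijl}$ with constants $\kappa_{ijl}$, and $\kappa:=\max_{i,j,l}\kappa_{ijl}$. For $\phi\in C([-\kappa,0],\mathbb R^N)$, $u(t;\phi)$ denotes the solution of (GNN) for $t\ge0$ with $u(s;\phi)=\phi(s)$ on $[-\kappa,0]$, and $u_t(s;\phi)=u(t+s;\phi)$, $s\in[-\kappa,0]$. **Almost periodic** is in the sense of Bohr: a continuous $f:\mathbb R\to\mathbb R$ such that for each $\epsilon>0$ the set $\{T:|f(t+T)-f(t)|<\epsilon\ \forall t\in\mathbb R\}$ is relatively dense. **$(H_1)$**: $c_i(t)>0$, $a_{ijl}(t)$, $\kappa_{ijl}(t)>0$,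 $J_i(t)$ are almost periodic functions on $\mathbb R$; $\sigma_j>0$ are constants; $a_{iil}(t)>0$. **Class $\mathcal A$**: $g_i\in C^2(\mathbb R)$, $|g_i(x)|\le B_i$ for a constant $B_i$, $g_i(0)=0$, $\dot g_i(x)>0$ for all $x\in\mathbb R$, and $x\ddot g_i(x)<0$ for all $x\ne0$. **Auxiliary functions**: $F_i(z)=-\big(\sup_{t}c_i(t)\big)z+\big(\inf_{t}\sum_{l=1}^M a_{iil}(t)\big)g_i(\sigma_i z)$. All $\sup$ and $\inf$ over $t$ are over $t\in\mathbb R$. **$(H_1^{\mathcal A})$**: for every $i$, $$\inf_{\zeta\in\mathbb R}\dot g_i(\zeta)<\frac{\sup_t c_i(t)}{\sigma_i\inf_t\sum_{l=1}^M a_{iil}(t)}<\sup_{\zeta\in\mathbb R}\dot g_i(\zeta)$$ (in particular $\inf_t\sum_l a_{iil}(t)>0$). Under this condition $\dot F_i$ has exactly two zeros $z_{i1}<0<z_{i2}$. **$(H_2^{\mathcal A})$**: for every $i$, $k=1,2$ and all $t\in\mathbb R$, $$(-1)^k\{F_i(z_{ik})+J_i(t)\}>\sum_{l=1}^M\sum_{j\ne i}\sup_{t}|a_{ijl}(t)|B_j .$$ **Basins**: $\beta_{i1}:=\hat z_{i1}$ is the point $\hat z_{i1}<z_{i1}$ with $F_i(\hat z_{i1})+\sum_{l}\sum_{j\ne i}\sup_t|a_{ijl}(t)|B_j+\sup_tJ_i(t)=0$; $\alpha_{i2}:=\tilde z_{i2}$ is the point $\tilde z_{i2}>z_{i2}$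 with $F_i(\tilde z_{i2})-\sum_{l}\sum_{j\ne i}\sup_t|a_{ijl}(t)|B_j+\inf_tJ_i(t)=0$. Set $$\mathcal K_{i1}=\{\psi\in C([-\kappa,0],\mathbb R):\psi(s)\le\beta_{i1}\ \forall s\},\qquad \mathcal K_{i2}=\{\psi\in C([-\kappa,0],\mathbb R):\psi(s)\ge\alpha_{i2}\ \forall s\},$$ and $\mathcal K^\Sigma=\mathcal K_{1\varsigma_1}\times\cdots\times\mathcal K_{N\varsigma_N}$ for $\Sigma=(\varsigma_1,\dots,\varsigma_N)\in\{1,2\}^N$. *)

theory Defs
  imports "HOL-Analysis.Analysis"
begin

definition relatively_dense :: "real set \<Rightarrow> bool" where
  "relatively_dense S \<longleftrightarrow> (\<exists>L>0. \<forall>x. \<exists>T\<in>S. x \<le> T \<and> T \<le> x + L)"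

definition almost_periodic :: "(real \<Rightarrow> real) \<Rightarrow> bool" where
  "almost_periodic f \<longleftrightarrow> continuous_on UNIV f \<and>
     (\<forall>\<epsilon>>0. relatively_dense {T. \<forall>t. \<bar>f (t + T) - f t\<bar> < \<epsilon>})"

text \<open>
  The indices \<open>i, j \<in> {1,\<dots>,N}\<close> and \<open>l \<in> {1,\<dots>,M}\<close> are elements of finite types
  \<open>'n\<close> and \<open>'m\<close>; as types are nonempty, \<open>N, M \<ge> 1\<close> is automatic. The
  coefficient \<open>a\<^sub>i\<^sub>j\<^sub>l(t)\<close> is written \<open>a i j l t\<close>, the delay
  \<open>\<kappa>\<^sub>i\<^sub>j\<^sub>l(t)\<close> is \<open>\<kappa> i j l t\<close>, and its constant bound is \<open>\<kappa>b i j l\<close>.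
\<close>

definition max_delay :: "('n::finite \<Rightarrow> 'n \<Rightarrow> 'm::finite \<Rightarrow> real) \<Rightarrow> real" where
  "max_delay \<kappa>b = Max (range (\<lambda>(i, j, l). \<kappa>b i j l))"

definition delays_bounded ::
  "('n::finite \<Rightarrow> 'n \<Rightarrow> 'm::finite \<Rightarrow> real \<Rightarrow> real) \<Rightarrow> ('n \<Rightarrow> 'n \<Rightarrow> 'm \<Rightarrow> real) \<Rightarrow> bool"
where
  "delays_bounded \<kappa> \<kappa>b \<longleftrightarrow> (\<forall>i j l t. 0 < \<kappa> i j l t \<and> \<kappa> i j l t \<le> \<kappa>b i j l)"

definition cond_H1 ::
  "('n::finite \<Rightarrow> real \<Rightarrow> real) \<Rightarrow> ('n \<Rightarrow> 'n \<Rightarrow> 'm::finite \<Rightarrow> real \<Rightarrow> real) \<Rightarrow>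
   ('n \<Rightarrow> real) \<Rightarrow> ('n \<Rightarrow> 'n \<Rightarrow> 'm \<Rightarrow> real \<Rightarrow> real) \<Rightarrow> ('n \<Rightarrow> real \<Rightarrow> real) \<Rightarrow> bool"
where
  "cond_H1 c a \<sigma> \<kappa> J \<longleftrightarrow>
     (\<forall>i. almost_periodic (c i) \<and> (\<forall>t. 0 < c i t)) \<and>
     (\<forall>i j l. almost_periodic (a i j l)) \<and>
     (\<forall>i l t. 0 < a i i l t) \<and>
     (\<forall>i j l. almost_periodic (\<kappa> i j l) \<and> (\<forall>t. 0 < \<kappa> i j l t)) \<and>
     (\<forall>i. almost_periodic (J i)) \<and>
     (\<forall>j. 0 < \<sigma> j)"

definition C2 :: "(real \<Rightarrow> real) \<Rightarrow> bool" where
  "C2 f \<longleftrightarrow> (\<forall>x. f differentiable at x) \<and> (\<forall>x. deriv f differentiable at x) \<and>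
     continuous_on UNIV (deriv (deriv f))"

definition class_A :: "(real \<Rightarrow> real) \<Rightarrow> real \<Rightarrow> bool" where
  "class_A g B \<longleftrightarrow> C2 g \<and> (\<forall>x. \<bar>g x\<bar> \<le> B) \<and> g 0 = 0 \<and>
     (\<forall>x. 0 < deriv g x) \<and> (\<forall>x. x \<noteq> 0 \<longrightarrow> x * deriv (deriv g) x < 0)"

definition aux_F ::
  "('n::finite \<Rightarrow> real \<Rightarrow> real) \<Rightarrow> ('n \<Rightarrow> 'n \<Rightarrow> 'm::finite \<Rightarrow> real \<Rightarrow> real) \<Rightarrow>
   ('n \<Rightarrow> real \<Rightarrow> real) \<Rightarrow> ('n \<Rightarrow> real) \<Rightarrow> 'n \<Rightarrow> real \<Rightarrow> real"
where
  "aux_F c a g \<sigma> i z =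
     - (SUP t. c i t) * z + (INF t. \<Sum>l\<in>UNIV. a i i l t) * g i (\<sigma> i * z)"

text \<open>
  Under \<open>cond_H1A\<close> below, the derivative of \<open>aux_F\<close> has exactly one negative zero
  (\<open>k = 1\<close>) and exactly one positive zero (\<open>k = 2\<close>).
\<close>

definition crit_pt ::
  "('n::finite \<Rightarrow> real \<Rightarrow> real) \<Rightarrow> ('n \<Rightarrow> 'n \<Rightarrow> 'm::finite \<Rightarrow> real \<Rightarrow> real) \<Rightarrow>
   ('n \<Rightarrow> real \<Rightarrow> real) \<Rightarrow> ('n \<Rightarrow> real) \<Rightarrow> 'n \<Rightarrow> nat \<Rightarrow> real"
where
  "crit_pt c a g \<sigma> i k =
     (THE z. deriv (aux_F c a g \<sigma> i) z = 0 \<and> (if k = 1 then z < 0 else 0 < z))"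

definition cross_bound ::
  "('n::finite \<Rightarrow> 'n \<Rightarrow> 'm::finite \<Rightarrow> real \<Rightarrow> real) \<Rightarrow> ('n \<Rightarrow> real) \<Rightarrow> 'n \<Rightarrow> real"
where
  "cross_bound a B i = (\<Sum>l\<in>UNIV. \<Sum>j\<in>UNIV - {i}. (SUP t. \<bar>a i j l t\<bar>) * B j)"

definition cond_H1A ::
  "('n::finite \<Rightarrow> real \<Rightarrow> real) \<Rightarrow> ('n \<Rightarrow> 'n \<Rightarrow> 'm::finite \<Rightarrow> real \<Rightarrow> real) \<Rightarrow>
   ('n \<Rightarrow> real \<Rightarrow> real) \<Rightarrow> ('n \<Rightarrow> real) \<Rightarrow> bool"
where
  "cond_H1A c a g \<sigma> \<longleftrightarrow> (\<forall>i.
     0 < (INF t. \<Sum>l\<in>UNIV. a i i l t) \<and>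
     (INF \<zeta>. deriv (g i) \<zeta>) < (SUP t. c i t) / (\<sigma> i * (INF t. \<Sum>l\<in>UNIV. a i i l t)) \<and>
     (SUP t. c i t) / (\<sigma> i * (INF t. \<Sum>l\<in>UNIV. a i i l t)) < (SUP \<zeta>. deriv (g i) \<zeta>))"

definition cond_H2A ::
  "('n::finite \<Rightarrow> real \<Rightarrow> real) \<Rightarrow> ('n \<Rightarrow> 'n \<Rightarrow> 'm::finite \<Rightarrow> real \<Rightarrow> real) \<Rightarrow>
   ('n \<Rightarrow> real \<Rightarrow> real) \<Rightarrow> ('n \<Rightarrow> real) \<Rightarrow> ('n \<Rightarrow> real \<Rightarrow> real) \<Rightarrow> ('n \<Rightarrow> real) \<Rightarrow> bool"
where
  "cond_H2A c a g \<sigma> J B \<longleftrightarrow> (\<forall>i. \<forall>k\<in>{1, 2}. \<forall>t.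
     (- 1) ^ k * (aux_F c a g \<sigma> i (crit_pt c a g \<sigma> i k) + J i t) > cross_bound a B i)"

text \<open>
  The points \<open>\<beta>\<^sub>i\<^sub>1\<close> and \<open>\<alpha>\<^sub>i\<^sub>2\<close> are described by predicates rather than by
  definite descriptions: there is at most one such point, but if \<open>sup J\<^sub>i\<close>
  (or \<open>inf J\<^sub>i\<close>) is not attained, \<open>cond_H2A\<close> also admits the borderline case in which
  the equation holds at \<open>z\<^sub>i\<^sub>k\<close> itself and no such point exists.
\<close>

definition lower_pt ::
  "('n::finite \<Rightarrow> real \<Rightarrow> real) \<Rightarrow> ('n \<Rightarrow> 'n \<Rightarrow> 'm::finite \<Rightarrow> real \<Rightarrow> real) \<Rightarrow>
   ('n \<Rightarrow> real \<Rightarrow> real) \<Rightarrow> ('n \<Rightarrow> real) \<Rightarrow> ('n \<Rightarrow> real \<Rightarrow> real) \<Rightarrow> ('n \<Rightarrow> real) \<Rightarrow>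
   'n \<Rightarrow> real \<Rightarrow> bool"
where
  "lower_pt c a g \<sigma> J B i z \<longleftrightarrow> z < crit_pt c a g \<sigma> i 1 \<and>
     aux_F c a g \<sigma> i z + cross_bound a B i + (SUP t. J i t) = 0"

definition upper_pt ::
  "('n::finite \<Rightarrow> real \<Rightarrow> real) \<Rightarrow> ('n \<Rightarrow> 'n \<Rightarrow> 'm::finite \<Rightarrow> real \<Rightarrow> real) \<Rightarrow>
   ('n \<Rightarrow> real \<Rightarrow> real) \<Rightarrow> ('n \<Rightarrow> real) \<Rightarrow> ('n \<Rightarrow> real \<Rightarrow> real) \<Rightarrow> ('n \<Rightarrow> real) \<Rightarrow>
   'n \<Rightarrow> real \<Rightarrow> bool"
where
  "upper_pt c a g \<sigma> J B i z \<longleftrightarrow> crit_pt c a g \<sigma> i 2 < z \<and>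
     aux_F c a g \<sigma> i z - cross_bound a B i + (INF t. J i t) = 0"

text \<open>
  Elements of \<open>C([-r,0],X)\<close> are represented by functions on the reals that are
  continuous on \<open>{-r..0}\<close>; their values elsewhere are irrelevant.
\<close>

definition basin_component ::
  "real \<Rightarrow> ('n \<Rightarrow> real) \<Rightarrow> ('n \<Rightarrow> real) \<Rightarrow> 'n \<Rightarrow> nat \<Rightarrow> (real \<Rightarrow> real) set"
where
  "basin_component r \<beta> \<alpha> i k = {\<psi>. continuous_on {-r..0} \<psi> \<and>
     (\<forall>s\<in>{-r..0}. if k = 1 then \<psi> s \<le> \<beta> i else \<alpha> i \<le> \<psi> s)}"

definition basin ::
  "real \<Rightarrow> ('n::finite \<Rightarrow> real) \<Rightarrow> ('n \<Rightarrow> real) \<Rightarrow> ('n \<Rightarrow> nat) \<Rightarrow> (real \<Rightarrow> real ^ 'n) set"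
where
  "basin r \<beta> \<alpha> \<Sigma> = {\<phi>. \<forall>i. (\<lambda>s. \<phi> s $ i) \<in> basin_component r \<beta> \<alpha> i (\<Sigma> i)}"

definition gnn_rhs ::
  "('n::finite \<Rightarrow> real \<Rightarrow> real) \<Rightarrow> ('n \<Rightarrow> 'n \<Rightarrow> 'm::finite \<Rightarrow> real \<Rightarrow> real) \<Rightarrow>
   ('n \<Rightarrow> real \<Rightarrow> real) \<Rightarrow> ('n \<Rightarrow> real) \<Rightarrow> ('n \<Rightarrow> 'n \<Rightarrow> 'm \<Rightarrow> real \<Rightarrow> real) \<Rightarrow>
   ('n \<Rightarrow> real \<Rightarrow> real) \<Rightarrow> (real \<Rightarrow> real ^ 'n) \<Rightarrow> 'n \<Rightarrow> real \<Rightarrow> real"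
where
  "gnn_rhs c a g \<sigma> \<kappa> J u i t =
     - c i t * u t $ i
     + (\<Sum>l\<in>UNIV. \<Sum>j\<in>UNIV. a i j l t * g j (\<sigma> j * u (t - \<kappa> i j l t) $ j))
     + J i t"

text \<open>At \<open>t = 0\<close> the derivative is one-sided.\<close>

definition gnn_solution ::
  "('n::finite \<Rightarrow> real \<Rightarrow> real) \<Rightarrow> ('n \<Rightarrow> 'n \<Rightarrow> 'm::finite \<Rightarrow> real \<Rightarrow> real) \<Rightarrow>
   ('n \<Rightarrow> real \<Rightarrow> real) \<Rightarrow> ('n \<Rightarrow> real) \<Rightarrow> ('n \<Rightarrow> 'n \<Rightarrow> 'm \<Rightarrow> real \<Rightarrow> real) \<Rightarrow>
   ('n \<Rightarrow> real \<Rightarrow> real) \<Rightarrow> real \<Rightarrow> (real \<Rightarrow> real ^ 'n) \<Rightarrow> (real \<Rightarrow> real ^ 'n) \<Rightarrow> bool"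
where
  "gnn_solution c a g \<sigma> \<kappa> J r \<phi> u \<longleftrightarrow>
     (\<forall>s\<in>{-r..0}. u s = \<phi> s) \<and>
     (\<forall>t\<ge>0. \<forall>i. ((\<lambda>t. u t $ i) has_real_derivative gnn_rhs c a g \<sigma> \<kappa> J u i t)
        (at t within {0..}))"

definition history :: "(real \<Rightarrow> 'a) \<Rightarrow> real \<Rightarrow> real \<Rightarrow> 'a" where
  "history u t = (\<lambda>s. u (t + s))"

end

theory Submission
  imports Defs
begin

text \<open>
  Beyond the critical points, the auxiliary function \<open>F\<^sub>i\<close> is strictly decreasing. Hence every
  level \<open>q\<close> strictly between \<open>z\<^sub>i\<^sub>2\<close> and \<open>\<alpha>\<^sub>i\<close> is a strict barrier: if the \<open>i\<close>-th component
  reaches \<open>q\<close> for the first time at \<open>t\<close>, its whole past is at least \<open>q\<close>, and monotonicity of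
  \<open>g\<^sub>i\<close> makes its derivative at \<open>t\<close> at least \<open>F\<^sub>i(q)\<close> minus the cross bound plus \<open>inf J\<^sub>i\<close>, which
  is positive. So no such \<open>q\<close> is ever reached. The lower basins follow by the symmetry
  \<open>u \<mapsto> - u\<close>, carried along as a sign \<open>e\<close> with \<open>e = 1\<close> or \<open>e = -1\<close>.
\<close>

section \<open>Boundedness of almost periodic functions\<close>

lemma almost_periodic_bounded:
  assumes "almost_periodic f"
  obtains K where "\<And>t. \<bar>f t\<bar> \<le> K"
proof -
  have cont: "continuous_on UNIV f" and "relatively_dense {T. \<forall>t. \<bar>f (t + T) - f t\<bar> < 1}"
    using assms unfolding almost_periodic_def by auto
  then obtain L where L: "\<And>x. \<exists>T. (\<forall>t. \<bar>f (t + T) - f t\<bar> < 1) \<and> x \<le> T \<and> T \<le> x + L"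
    unfolding relatively_dense_def by auto
  have "compact (f ` {0..L})"
    by (intro compact_continuous_image continuous_on_subset[OF cont]) auto
  then have "bounded (f ` {0..L})" by (rule compact_imp_bounded)
  then obtain K where K: "\<forall>x\<in>{0..L}. \<bar>f x\<bar> \<le> K"
    unfolding bounded_iff real_norm_def by blast
  have "\<bar>f t\<bar> \<le> K + 1" for t
  proof -
    \<comment> \<open>An almost period chosen in an interval of length L starting at -t moves t into
      \<open>{0..L}\<close>, where \<open>f\<close> is bounded by compactness; the shift costs at
      most 1.\<close>
    obtain T where T: "\<And>t. \<bar>f (t + T) - f t\<bar> < 1" "-t \<le> T" "T \<le> -t + L"
      using L[of "-t"] by blast
    have "\<bar>f (t + T)\<bar> \<le> K" using K[rule_format, of "t + T"] T(2,3) by simp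
    with T(1)[of t] show ?thesis by linarith
  qed
  then show thesis by (rule that)
qed

text \<open>On the reals \<open>SUP\<close> and \<open>INF\<close> bound the values of a function
  only if its range is bounded; these facts allow coefficients to be compared with their
  extrema.\<close>

lemma almost_periodic_bdd:
  assumes "almost_periodic f"
  shows "bdd_above (range f)" "bdd_below (range f)" "bdd_above (range (\<lambda>t. \<bar>f t\<bar>))"
proof -
  obtain K where K: "\<And>t. \<bar>f t\<bar> \<le> K" using almost_periodic_bounded[OF assms] by blast
  show "bdd_above (range f)" using K by (intro bdd_aboveI[of _ K]) (auto simp: abs_le_iff)
  show "bdd_below (range f)"
    by (intro bdd_belowI[of _ "-K"]) (use K in \<open>auto simp: abs_le_iff minus_le_iff\<close>)
  show "bdd_above (range (\<lambda>t. \<bar>f t\<bar>))" using K by (intro bdd_aboveI[of _ K]) auto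
qed

subsection \<open>Activation functions of class A\<close>

lemma class_A_has_derivs:
  assumes "class_A g B"
  shows "(g has_real_derivative deriv g x) (at x)"
    and "(deriv g has_real_derivative deriv (deriv g) x) (at x)"
  using assms unfolding class_A_def C2_def
  by (auto intro!: DERIV_deriv_iff_real_differentiable[THEN iffD2])

lemma class_A_strict_mono:
  assumes "class_A g B"
  shows "strict_mono g"
proof (rule strict_monoI)
  fix x y :: real assume "x < y"
  moreover have "\<And>x. 0 < deriv g x" using assms unfolding class_A_def by auto
  ultimately show "g x < g y"
    by (intro DERIV_pos_imp_increasing[of x y g]) (use class_A_has_derivs(1)[OF assms] in auto)
qed

lemma class_A_deriv_strict_antimono:
  assumes "class_A g B" "0 \<le> x" "x < y"
  shows "deriv g y < deriv g x"
\<comment> \<open>The open version asks for the sign of the second derivative at interior points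
  only, so x = 0 is allowed although class A gives no negative sign there.\<close>
proof (rule DERIV_neg_imp_decreasing_open[of x y "deriv g"])
  show "x < y" by fact
  show "continuous_on {x..y} (deriv g)"
    using class_A_has_derivs(2)[OF assms(1)]
    by (auto intro!: continuous_at_imp_continuous_on DERIV_isCont)
  fix z assume "x < z" "z < y"
  with assms have "0 < z" by simp
  moreover from this have "z * deriv (deriv g) z < 0"
    using assms(1) unfolding class_A_def by auto
  ultimately have "deriv (deriv g) z < 0" by (simp add: mult_less_0_iff)
  then show "\<exists>d. (deriv g has_real_derivative d) (at z) \<and> d < 0"
    using class_A_has_derivs(2)[OF assms(1)] by blast
qed

text \<open>The reflected activation governs \<open>e * u\<close>. Since \<open>g\<close> need not
  be odd, it is in general another function, but every condition of class A is symmetric under the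
  reflection. In its first derivative the two factors \<open>e\<close> cancel.\<close>

lemma class_A_reflect:
  fixes e :: real
  assumes "class_A g B" and e: "e = 1 \<or> e = -1"
  shows "class_A (\<lambda>x. e * g (e * x)) B" and "deriv (\<lambda>x. e * g (e * x)) = (\<lambda>x. deriv g (e * x))"
proof -
  note d = class_A_has_derivs[OF assms(1)]
  have ee': "e * (y * e) = y" for y using e by auto
  have D1: "((\<lambda>x. e * g (e * x)) has_real_derivative deriv g (e * x)) (at x)" for x
    using DERIV_cmult[OF DERIV_chain2[OF d(1)[of "e * x"] DERIV_cmult_Id[of e x UNIV]], of e] ee'
    by (simp only:)
  then show eq: "deriv (\<lambda>x. e * g (e * x)) = (\<lambda>x. deriv g (e * x))"
    by (auto intro!: DERIV_imp_deriv)
  have D2: "((\<lambda>x. deriv g (e * x)) has_real_derivative e * deriv (deriv g) (e * x)) (at x)" for x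
    using DERIV_chain2[OF d(2)[of "e * x"] DERIV_cmult_Id[of e x UNIV]]
    by (simp only: mult.commute)
  then have eq2: "deriv (\<lambda>x. deriv g (e * x)) = (\<lambda>x. e * deriv (deriv g) (e * x))"
    by (auto intro!: DERIV_imp_deriv)
  have "continuous_on UNIV (deriv (deriv g))" using assms unfolding class_A_def C2_def by auto
  then have "continuous_on UNIV (\<lambda>x. e * deriv (deriv g) (e * x))"
    by (intro continuous_on_mult_left continuous_on_compose2[of UNIV "deriv (deriv g)" UNIV "\<lambda>x. e * x"]
        continuous_on_id subset_UNIV)
  moreover have "x * (e * deriv (deriv g) (e * x)) < 0" if "x \<noteq> 0" for x
  proof -
    have "e * x \<noteq> 0" using that e by auto
    moreover have "\<And>y. y \<noteq> 0 \<Longrightarrow> y * deriv (deriv g) y < 0"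
      using assms(1) unfolding class_A_def by auto
    ultimately have "(e * x) * deriv (deriv g) (e * x) < 0" by blast
    then show ?thesis by (simp only: mult.assoc mult.left_commute)
  qed
  moreover have "\<bar>e * g (e * x)\<bar> \<le> B" for x
  proof -
    have "\<bar>g (e * x)\<bar> \<le> B" using assms(1) unfolding class_A_def by simp
    moreover have "\<bar>e\<bar> = 1" using e by auto
    ultimately show ?thesis by (simp add: abs_mult)
  qed
  moreover have "(\<lambda>x. e * g (e * x)) differentiable at x"
    "(\<lambda>x. deriv g (e * x)) differentiable at x" for x
    using D1[of x] D2[of x] real_differentiable_def by blast+
  ultimately show "class_A (\<lambda>x. e * g (e * x)) B"
    using assms(1) unfolding class_A_def C2_def eq eq2 by simp
qed

text \<open>The slope of \<open>g\<close> is largest at 0: it decreases along the positive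
  half-line, and negative arguments become positive ones by reflection with e = -1.\<close>

lemma class_A_sup_deriv:
  assumes "class_A g B" "y < (SUP x. deriv g x)"
  shows "y < deriv g 0"
proof -
  obtain x where x: "y < deriv g x" using less_cSupE[OF assms(2)] by auto
  have "deriv g x \<le> deriv g 0"
  proof (cases x "0::real" rule: linorder_cases)
    case less
    then show ?thesis
      using class_A_deriv_strict_antimono[OF class_A_reflect(1)[OF assms(1), of "-1"], of 0 "-x"]
      by (simp add: class_A_reflect(2)[OF assms(1), of "-1", simplified])
  next
    case greater
    then show ?thesis using class_A_deriv_strict_antimono[OF assms(1), of 0 x] by simp
  qed simp
  with x show ?thesis by simp
qed

text \<open>The derivative of \<open>h\<close> vanishes where the slope of \<open>g\<close> at s * z
  meets the level C / (s * K). On the positive half-line that slope starts above the level,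
  decreases strictly, and ends below it because \<open>g\<close> is bounded; hence there is one
  crossing, and \<open>h\<close> falls beyond it.\<close>

lemma class_A_turning_point:
  assumes A: "class_A g B" and pos: "0 < C" "0 < K" "0 < s" and q: "C / (s * K) < deriv g 0"
  defines "h \<equiv> \<lambda>z. - C * z + K * g (s * z)"
  obtains p where "0 < p" "deriv h p = 0" "\<And>z. 0 < z \<Longrightarrow> deriv h z = 0 \<Longrightarrow> z = p"
    "\<And>x y. p \<le> x \<Longrightarrow> x < y \<Longrightarrow> h y < h x"
proof -
  note d = class_A_has_derivs[OF A]
  let ?q = "C / (s * K)"
  have q0: "?q > 0" using pos by simp
  have B: "\<bar>g x\<bar> \<le> B" "g 0 = 0" for x using A unfolding class_A_def by auto
  have B0: "0 \<le> B" using B(1)[of 0] by simp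
  text \<open>Boundedness of \<open>g\<close> forces its derivative below any positive level on the half-line.\<close>
  define X where "X = (B + 1) / ?q"
  have X: "X > 0" using B0 q0 unfolding X_def by (simp only: zero_less_divide_iff) auto
  \<comment> \<open>The mean slope of \<open>g\<close> over \<open>{0..X}\<close> is at most B / X,
    whereas X was chosen so that \<open>?q\<close> equals (B + 1) / X.\<close>
  obtain x1 where x1: "0 < x1" "x1 < X" "g X - g 0 = (X - 0) * deriv g x1"
    using MVT2[of 0 X g "deriv g"] X d(1) by blast
  have "X * deriv g x1 < X * ?q"
  proof -
    have "X * ?q = B + 1" using q0 nonzero_eq_divide_eq[of ?q X "B + 1"] X_def by (metis less_irrefl)
    then show ?thesis using x1 B(1)[of X] B(2) by auto
  qed
  then have lt: "deriv g x1 < ?q" using X mult_less_cancel_left_pos by blast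
  have "\<exists>x\<ge>0. x \<le> x1 \<and> deriv g x = ?q"
    by (rule IVT2) (use lt q x1 d(2) in \<open>auto intro: DERIV_isCont\<close>)
  then obtain x0 where x0: "0 \<le> x0" "deriv g x0 = ?q" by blast
  with q have x0p: "0 < x0" by (cases "x0 = 0") auto
  define p where "p = x0 / s"
  have p: "0 < p" "s * p = x0" using x0p pos unfolding p_def by auto
  have Dh: "(h has_real_derivative (- C + K * (s * deriv g (s * z)))) (at z)" for z
    unfolding h_def by (rule derivative_eq_intros DERIV_chain2[OF d(1)] refl)+ simp
  have h': "deriv h z = - C + K * (s * deriv g (s * z))" for z
    using Dh by (rule DERIV_imp_deriv)
  \<comment> \<open>Writing the level as the slope of \<open>g\<close> at s * p reduces zeros and
    signs of the derivative of \<open>h\<close> to the monotonicity of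
    \<open>deriv g\<close>.\<close>
  have zero: "deriv h z = 0 \<longleftrightarrow> deriv g (s * z) = deriv g (s * p)" for z
    unfolding h' p x0 using pos by (auto simp: field_simps)
  have neg: "deriv h z < 0" if "p < z" for z
  proof -
    have "deriv g (s * z) < deriv g (s * p)"
      using that p pos by (intro class_A_deriv_strict_antimono[OF A]) auto
    then show ?thesis unfolding h' p x0 using pos by (auto simp: field_simps)
  qed
  show thesis
  proof (rule that[of p])
    show "0 < p" "deriv h p = 0" using p zero by auto
    fix z assume z: "0 < z" "deriv h z = 0"
    then show "z = p"
      using class_A_deriv_strict_antimono[OF A, of "s * z" "s * p"] p pos zero[of z]
        class_A_deriv_strict_antimono[OF A, of "s * p" "s * z"]
      by (cases z p rule: linorder_cases) auto
  next
    fix x y assume xy: "p \<le> x" "x < y"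
    show "h y < h x"
    proof (rule DERIV_neg_imp_decreasing_open[of x y h, OF xy(2)])
      show "continuous_on {x..y} h"
        using Dh by (auto intro!: continuous_at_imp_continuous_on DERIV_isCont)
      fix z assume "x < z" "z < y"
      then show "\<exists>d. (h has_real_derivative d) (at z) \<and> d < 0"
        using Dh[of z] neg[of z] xy unfolding h' by auto
    qed
  qed
qed

subsection \<open>The barrier argument\<close>

text \<open>In the application the estimate of the derivative degenerates to 0 at m itself, so
  \<open>inward\<close> is demanded only at levels strictly below m, and a drop below m is refuted
  at an intermediate level.\<close>

lemma barrier:
  fixes v v' :: "real \<Rightarrow> real"
  assumes der: "\<And>t. 0 \<le> t \<Longrightarrow> (v has_real_derivative v' t) (at t within {0..})"
    and init: "\<And>s. - r \<le> s \<Longrightarrow> s \<le> 0 \<Longrightarrow> m \<le> v s"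
    and "p < m" "0 \<le> r"
    and inward: "\<And>q t. p < q \<Longrightarrow> q < m \<Longrightarrow> 0 < t \<Longrightarrow> v t = q \<Longrightarrow>
      (\<And>s. - r \<le> s \<Longrightarrow> s \<le> t \<Longrightarrow> q \<le> v s) \<Longrightarrow> 0 < v' t"
    and "- r \<le> t"
  shows "m \<le> v t"
proof (rule ccontr)
  assume "\<not> m \<le> v t"
  then have vt: "v t < m" and t: "0 < t" using init[of t] \<open>- r \<le> t\<close> by force+
  \<comment> \<open>Above p the level q is subject to \<open>inward\<close>; above
    \<open>v t\<close> it must have been reached by time t.\<close>
  obtain q where "max p (v t) < q" "q < m" using dense[of "max p (v t)" m] vt \<open>p < m\<close> by auto
  then have q: "p < q" "v t < q" "q < m" by auto
  have cont: "continuous_on {0..} v"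
    using der by (auto simp: continuous_on_eq_continuous_within intro: DERIV_continuous)
  \<comment> \<open>The infimum of this closed set is the first time at which v is at most
    q.\<close>
  define S where "S = {0..t} \<inter> v -` {..q}"
  have "closed S" unfolding S_def
    by (intro continuous_closed_preimage continuous_on_subset[OF cont]) auto
  moreover have bdd: "bdd_below S" unfolding S_def by (auto intro: bdd_belowI[of _ 0])
  moreover have "t \<in> S" using q t unfolding S_def by simp
  ultimately have "Inf S \<in> S" by (intro closed_contains_Inf) auto
  then obtain t0 where t0: "t0 = Inf S" "0 \<le> t0" "t0 \<le> t" "v t0 \<le> q"
    unfolding S_def by auto
  have first: "q < v s" if "0 \<le> s" "s < t0" for s
  proof (rule ccontr)
    assume "\<not> q < v s"
    then have "s \<in> S" using that t0 unfolding S_def by auto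
    then show False using cInf_lower[OF _ bdd] that t0 by fastforce
  qed
  have v0: "q < v 0" using init[of 0] q \<open>0 \<le> r\<close> by auto
  then have t0p: "0 < t0" using t0 by (cases "t0 = 0") auto
  obtain x where "0 \<le> x" "x \<le> t0" "v x = q"
    using IVT2'[of v t0 q 0] v0 t0 continuous_on_subset[OF cont] by force
  with first have vt0: "v t0 = q" by (cases "x = t0") force+
  have "q \<le> v s" if s: "- r \<le> s" "s \<le> t0" for s
  proof -
    consider "s \<le> 0" | "0 \<le> s" "s < t0" | "s = t0" using s by linarith
    then show ?thesis using init[of s] first[of s] vt0 q s by cases auto
  qed
  then have "0 < v' t0" using q t0p vt0 inward by blast
  then obtain d where d: "d > 0" "\<And>h. h > 0 \<Longrightarrow> t0 - h \<in> {0..} \<Longrightarrow> h < d \<Longrightarrow> v (t0 - h) < v t0"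
    using has_real_derivative_pos_inc_left[OF der[of t0]] t0p by force
  \<comment> \<open>Half of each bound keeps t0 - h positive and within the range where v lies below
    \<open>v t0\<close>; but before t0 all values exceed q.\<close>
  define h where "h = min (d / 2) (t0 / 2)"
  have h: "0 < h" "h < d" "h < t0" using d(1) t0p unfolding h_def by auto
  then show False using d(2)[of h] first[of "t0 - h"] vt0 by auto
qed

text \<open>Decay, self-coupling and cross terms are estimated separately. Only the component's own
  past is constrained: the other components enter through the bounds \<open>B j\<close> alone, so
  each component can be treated in isolation.\<close>

lemma gnn_rhs_pos:
  fixes c J g :: "'n::finite \<Rightarrow> real \<Rightarrow> real"
    and a \<kappa> :: "'n \<Rightarrow> 'n \<Rightarrow> 'm::finite \<Rightarrow> real \<Rightarrow> real"
    and e q :: real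
  assumes H1: "cond_H1 c a \<sigma> \<kappa> J" and A: "\<And>i. class_A (g i) (B i)"
    and e: "e = 1 \<or> e = -1" and "0 < q"
    and now: "e * u t $ i = q" and past: "\<And>l. q \<le> e * u (t - \<kappa> i i l t) $ i"
    and F: "0 < e * aux_F c a g \<sigma> i (e * q) - cross_bound a B i + e * J i t"
  shows "0 < e * gnn_rhs c a g \<sigma> \<kappa> J u i t"
proof -
  let ?G = "\<lambda>x. e * g i (e * x)"
  have ee: "e * e = 1" using e by auto
  have ap: "almost_periodic (c i)" "almost_periodic (a i j l)" "0 < a i i l t" "0 < \<sigma> j"
    for j l t using H1 unfolding cond_H1_def by auto
  have AG: "class_A ?G (B i)" by (rule class_A_reflect(1)[OF A e])
  note mono = class_A_strict_mono[OF AG]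
  have G0: "?G 0 = 0" using A[of i] unfolding class_A_def by auto
  \<comment> \<open>The sign matters when the sum of self-coupling coefficients is replaced by its
    infimum.\<close>
  have Gq: "0 < ?G (\<sigma> i * q)"
    using strict_monoD[OF mono, of 0 "\<sigma> i * q"] ap(4)[of i] \<open>0 < q\<close> unfolding G0 by simp
  have c: "c i t * q \<le> (SUP t. c i t) * q"
    using \<open>0 < q\<close> cSUP_upper[OF UNIV_I almost_periodic_bdd(1)[OF ap(1)]] by auto
  have "bdd_below (range (\<lambda>t. \<Sum>l\<in>UNIV. a i i l t))"
    by (rule bdd_belowI[of _ 0]) (auto intro!: sum_nonneg less_imp_le[OF ap(3)])
  then have "(INF t. \<Sum>l\<in>UNIV. a i i l t) \<le> (\<Sum>l\<in>UNIV. a i i l t)"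
    by (rule cINF_lower) simp
  then have "(INF t. \<Sum>l\<in>UNIV. a i i l t) * ?G (\<sigma> i * q) \<le> (\<Sum>l\<in>UNIV. a i i l t) * ?G (\<sigma> i * q)"
    using Gq by (intro mult_right_mono) auto
  also have "\<dots> \<le> (\<Sum>l\<in>UNIV. a i i l t * (e * g i (\<sigma> i * u (t - \<kappa> i i l t) $ i)))"
    unfolding sum_distrib_right
  \<comment> \<open>Self-couplings are positive, so monotonicity of \<open>?G\<close> allows q to be
    replaced by the delayed values term by term.\<close>
  proof (rule sum_mono, rule mult_left_mono[OF _ less_imp_le[OF ap(3)]])
    fix l
    have "?G (\<sigma> i * q) \<le> ?G (\<sigma> i * (e * u (t - \<kappa> i i l t) $ i))"
      by (rule monoD[OF strict_mono_mono[OF mono]]) (use past[of l] ap(4)[of i] in simp)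
    also have "e * (\<sigma> i * (e * u (t - \<kappa> i i l t) $ i)) = \<sigma> i * u (t - \<kappa> i i l t) $ i"
      using ee by (simp add: algebra_simps flip: mult.assoc)
    finally show "?G (\<sigma> i * q) \<le> e * g i (\<sigma> i * u (t - \<kappa> i i l t) $ i)" .
  qed
  finally have self: "(INF t. \<Sum>l\<in>UNIV. a i i l t) * ?G (\<sigma> i * q)
      \<le> (\<Sum>l\<in>UNIV. a i i l t * (e * g i (\<sigma> i * u (t - \<kappa> i i l t) $ i)))" .
  have "\<bar>a i j l t * (e * g j x)\<bar> \<le> (SUP t. \<bar>a i j l t\<bar>) * B j" for j l x
  proof -
    have "\<bar>a i j l t\<bar> * \<bar>g j x\<bar> \<le> (SUP t. \<bar>a i j l t\<bar>) * B j"
      using A[of j] cSUP_upper[OF UNIV_I almost_periodic_bdd(3)[OF ap(2)[of j l]], of t]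
      by (intro mult_mono') (auto simp: class_A_def)
    then show ?thesis using e by (auto simp: abs_mult)
  qed
  then have "- ((SUP t. \<bar>a i j l t\<bar>) * B j) \<le> a i j l t * (e * g j x)" for j l x
    by (simp add: abs_le_iff minus_le_iff)
  then have cross: "- cross_bound a B i
      \<le> (\<Sum>l\<in>UNIV. \<Sum>j\<in>UNIV-{i}. a i j l t * (e * g j (\<sigma> j * u (t - \<kappa> i j l t) $ j)))"
    unfolding cross_bound_def sum_negf[symmetric] by (intro sum_mono)
  have "e * gnn_rhs c a g \<sigma> \<kappa> J u i t = - c i t * q
      + (\<Sum>l\<in>UNIV. \<Sum>j\<in>UNIV. a i j l t * (e * g j (\<sigma> j * u (t - \<kappa> i j l t) $ j))) + e * J i t"
    unfolding gnn_rhs_def now[symmetric] by (simp add: algebra_simps sum_distrib_left)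
  also have "(\<Sum>l\<in>UNIV. \<Sum>j\<in>UNIV. a i j l t * (e * g j (\<sigma> j * u (t - \<kappa> i j l t) $ j)))
      = (\<Sum>l\<in>UNIV. a i i l t * (e * g i (\<sigma> i * u (t - \<kappa> i i l t) $ i)))
      + (\<Sum>l\<in>UNIV. \<Sum>j\<in>UNIV-{i}. a i j l t * (e * g j (\<sigma> j * u (t - \<kappa> i j l t) $ j)))"
    by (simp add: sum.distrib[symmetric] sum.remove[of UNIV i])
  finally have rhs: "e * gnn_rhs c a g \<sigma> \<kappa> J u i t = - c i t * q
      + ((\<Sum>l\<in>UNIV. a i i l t * (e * g i (\<sigma> i * u (t - \<kappa> i i l t) $ i)))
      + (\<Sum>l\<in>UNIV. \<Sum>j\<in>UNIV-{i}. a i j l t * (e * g j (\<sigma> j * u (t - \<kappa> i j l t) $ j)))) + e * J i t" .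
  \<comment> \<open>Ring normalisation leaves the product \<open>e * e\<close> in place;
    \<open>ee\<close> removes it in the final step.\<close>
  have "e * aux_F c a g \<sigma> i (e * q)
      = - (SUP t. c i t) * (e * e * q) + (INF t. \<Sum>l\<in>UNIV. a i i l t) * ?G (\<sigma> i * q)"
    unfolding aux_F_def by (simp add: algebra_simps)
  then show ?thesis using F c self cross unfolding rhs ee by simp
qed

text \<open>Conjugated by \<open>e\<close>, the auxiliary function has the shape of \<open>h\<close>
  in \<open>class_A_turning_point\<close> for the reflected activation. Both critical points thus
  come from one statement about the positive half-line.\<close>

lemma aux_F_turning_point:
  fixes c J g :: "'n::finite \<Rightarrow> real \<Rightarrow> real"
    and a \<kappa> :: "'n \<Rightarrow> 'n \<Rightarrow> 'm::finite \<Rightarrow> real \<Rightarrow> real"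
  assumes H1: "cond_H1 c a \<sigma> \<kappa> J" and A: "class_A (g i) B" and H1A: "cond_H1A c a g \<sigma>"
    and k: "k = 1 \<and> e = -1 \<or> k = 2 \<and> e = 1"
  shows "0 < e * crit_pt c a g \<sigma> i k"
    and "\<And>x y. e * crit_pt c a g \<sigma> i k \<le> x \<Longrightarrow> x < y \<Longrightarrow>
      e * aux_F c a g \<sigma> i (e * y) < e * aux_F c a g \<sigma> i (e * x)"
proof -
  let ?C = "SUP t. c i t" and ?K = "INF t. \<Sum>l\<in>UNIV. a i i l t"
  let ?F = "aux_F c a g \<sigma> i" and ?G = "\<lambda>x. e * g i (e * x)"
  have e: "e = 1 \<or> e = -1" and ee: "e * e = 1" and ee': "e * (y * e) = y" for y
    using k by auto
  have ap: "almost_periodic (c i)" "0 < c i t" "0 < \<sigma> i" for t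
    using H1 unfolding cond_H1_def by auto
  have C: "0 < ?C"
    using ap(2)[of 0] cSUP_upper[OF UNIV_I almost_periodic_bdd(1)[OF ap(1)], of 0] by linarith
  have K: "0 < ?K" and "?C / (\<sigma> i * ?K) < (SUP x. deriv (g i) x)"
    using H1A unfolding cond_H1A_def by auto
  then have "?C / (\<sigma> i * ?K) < deriv ?G 0"
    using class_A_sup_deriv[OF A] by (simp add: class_A_reflect(2)[OF A e])
  from class_A_turning_point[OF class_A_reflect(1)[OF A e] C K ap(3) this]
  obtain p where p: "0 < p" "deriv (\<lambda>z. - ?C * z + ?K * ?G (\<sigma> i * z)) p = 0"
    "\<And>z. 0 < z \<Longrightarrow> deriv (\<lambda>z. - ?C * z + ?K * ?G (\<sigma> i * z)) z = 0 \<Longrightarrow> z = p"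
    "\<And>x y. p \<le> x \<Longrightarrow> x < y \<Longrightarrow>
      - ?C * y + ?K * ?G (\<sigma> i * y) < - ?C * x + ?K * ?G (\<sigma> i * x)"
    by blast
  have "(\<lambda>z. - ?C * z + ?K * ?G (\<sigma> i * z)) = (\<lambda>z. - ?C * (e * e * z) + ?K * ?G (\<sigma> i * z))"
    unfolding ee by simp
  also have "\<dots> = (\<lambda>z. e * ?F (e * z))"
    unfolding aux_F_def by (simp add: algebra_simps)
  finally have h: "(\<lambda>z. - ?C * z + ?K * ?G (\<sigma> i * z)) = (\<lambda>z. e * ?F (e * z))" .
  have DF: "(?F has_real_derivative - ?C + ?K * (\<sigma> i * deriv (g i) (\<sigma> i * z))) (at z)" for z
    unfolding aux_F_def
    by (rule derivative_eq_intros DERIV_chain2[OF class_A_has_derivs(1)[OF A]] refl)+ simp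
  then have "(?F has_real_derivative deriv ?F z) (at z)" for z
    by (metis DERIV_imp_deriv)
  then have "((\<lambda>z. e * ?F (e * z)) has_real_derivative deriv ?F (e * z)) (at z)" for z
    using DERIV_cmult[OF DERIV_chain2[OF _ DERIV_cmult_Id[of e z UNIV]], of ?F _ e] ee'
    by (simp only:)
  then have h': "deriv (\<lambda>z. e * ?F (e * z)) z = deriv ?F (e * z)" for z
    by (rule DERIV_imp_deriv)
  \<comment> \<open>Uniqueness of p among positive zeros resolves the definite description; for k =
    1 multiplication by e = -1 exchanges the half-lines.\<close>
  have crit: "crit_pt c a g \<sigma> i k = e * p"
    unfolding crit_pt_def
  proof (rule the_equality)
    show "deriv ?F (e * p) = 0 \<and> (if k = 1 then e * p < 0 else 0 < e * p)"
      using p(1,2) k unfolding h h' by auto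
    fix z assume z: "deriv ?F z = 0 \<and> (if k = 1 then z < 0 else 0 < z)"
    have "e * z = p"
    proof (rule p(3))
      show "0 < e * z" using z k by auto
      show "deriv (\<lambda>z. - ?C * z + ?K * ?G (\<sigma> i * z)) (e * z) = 0"
        unfolding h h' using z ee by (simp flip: mult.assoc)
    qed
    then show "z = e * p" using e by auto
  qed
  then have ecrit: "e * crit_pt c a g \<sigma> i k = p" using e by auto
  show "0 < e * crit_pt c a g \<sigma> i k" unfolding ecrit by (rule p(1))
  show "e * ?F (e * y) < e * ?F (e * x)" if "e * crit_pt c a g \<sigma> i k \<le> x" "x < y" for x y
    using p(4)[of x y] that unfolding ecrit h[THEN fun_cong] .
qed

text \<open>Here \<open>J0\<close> stands for the infimum of \<open>J i\<close> when e = 1 and for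
  minus its supremum when e = -1, so that one balance equation at m describes both kinds of basin
  boundary.\<close>

lemma component_invariant:
  fixes c J g :: "'n::finite \<Rightarrow> real \<Rightarrow> real"
    and a \<kappa> :: "'n \<Rightarrow> 'n \<Rightarrow> 'm::finite \<Rightarrow> real \<Rightarrow> real"
  assumes H1: "cond_H1 c a \<sigma> \<kappa> J" and A: "\<And>i. class_A (g i) (B i)"
    and H1A: "cond_H1A c a g \<sigma>"
    and k: "k = 1 \<and> e = -1 \<or> k = 2 \<and> e = 1"
    and \<kappa>: "\<And>l t. 0 < \<kappa> i i l t \<and> \<kappa> i i l t \<le> r"
    and sol: "gnn_solution c a g \<sigma> \<kappa> J r \<phi> u"
    and m: "e * crit_pt c a g \<sigma> i k < m"
      "e * aux_F c a g \<sigma> i (e * m) - cross_bound a B i + J0 = 0"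
    and J0: "\<And>t. J0 \<le> e * J i t"
    and init: "\<And>s. s \<in> {-r..0} \<Longrightarrow> m \<le> e * \<phi> s $ i"
    and t: "- r \<le> t"
  shows "m \<le> e * u t $ i"
proof (rule barrier[where v = "\<lambda>t. e * u t $ i" and p = "e * crit_pt c a g \<sigma> i k"
      and v' = "\<lambda>t. e * gnn_rhs c a g \<sigma> \<kappa> J u i t"])
  note tp = aux_F_turning_point[OF H1 A H1A k, of i]
  show "((\<lambda>t. e * u t $ i) has_real_derivative e * gnn_rhs c a g \<sigma> \<kappa> J u i t) (at t within {0..})"
    if "0 \<le> t" for t
    using sol that unfolding gnn_solution_def by (intro DERIV_cmult) blast
  show "m \<le> e * u s $ i" if "- r \<le> s" "s \<le> 0" for s
    using sol init[of s] that unfolding gnn_solution_def by auto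
  \<comment> \<open>Any index l serves; \<open>undefined\<close> merely names one.\<close>
  show "0 \<le> r" using \<kappa>[of undefined 0] by linarith
  fix q t
  assume q: "e * crit_pt c a g \<sigma> i k < q" "q < m" and "0 < t" and now: "e * u t $ i = q"
    and past: "\<And>s. - r \<le> s \<Longrightarrow> s \<le> t \<Longrightarrow> q \<le> e * u s $ i"
  show "0 < e * gnn_rhs c a g \<sigma> \<kappa> J u i t"
  proof (rule gnn_rhs_pos[OF H1 A ])
    show "e = 1 \<or> e = -1" "0 < q" using k tp(1) q by auto
    show "e * u t $ i = q" by (rule now)
    \<comment> \<open>A delay between 0 and r puts the delayed time between -r and t.\<close>
    show "q \<le> e * u (t - \<kappa> i i l t) $ i" for l
      using \<kappa>[of l t] \<open>0 < t\<close> by (intro past) auto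
    \<comment> \<open>The balance vanishes at m; strict decrease beyond the critical point makes it
      positive at q < m.\<close>
    show "0 < e * aux_F c a g \<sigma> i (e * q) - cross_bound a B i + e * J i t"
      using tp(2)[of q m] q m(2) J0[of t] by linarith
  qed
qed (use m t in auto)

section \<open>Positive invariance of the product basins\<close>

theorem theorem1:
  fixes c J g :: "'n::finite \<Rightarrow> real \<Rightarrow> real"
    and a \<kappa> :: "'n \<Rightarrow> 'n \<Rightarrow> 'm::finite \<Rightarrow> real \<Rightarrow> real"
    and \<kappa>b :: "'n \<Rightarrow> 'n \<Rightarrow> 'm \<Rightarrow> real"
    and \<sigma> B \<beta> \<alpha> :: "'n \<Rightarrow> real"
  assumes "delays_bounded \<kappa> \<kappa>b"
    and "cond_H1 c a \<sigma> \<kappa> J"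
    and "\<And>i. class_A (g i) (B i)"
    and "cond_H1A c a g \<sigma>"
    and "cond_H2A c a g \<sigma> J B"
    and "\<And>i. lower_pt c a g \<sigma> J B i (\<beta> i)"
    and "\<And>i. upper_pt c a g \<sigma> J B i (\<alpha> i)"
  shows "\<forall>\<Sigma>. (\<forall>i. \<Sigma> i \<in> {1, 2}) \<longrightarrow>
    (\<forall>\<phi>\<in>basin (max_delay \<kappa>b) \<beta> \<alpha> \<Sigma>. \<forall>u.
       gnn_solution c a g \<sigma> \<kappa> J (max_delay \<kappa>b) \<phi> u \<longrightarrow>
       (\<forall>t\<ge>0. history u t \<in> basin (max_delay \<kappa>b) \<beta> \<alpha> \<Sigma>))"
proof (intro allI impI ballI)
  fix \<Sigma> :: "'n \<Rightarrow> nat" and \<phi> u and t :: real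
  let ?r = "max_delay \<kappa>b"
  assume \<Sigma>: "\<forall>i. \<Sigma> i \<in> {1, 2}" and \<phi>: "\<phi> \<in> basin ?r \<beta> \<alpha> \<Sigma>"
    and sol: "gnn_solution c a g \<sigma> \<kappa> J ?r \<phi> u" and "0 \<le> t"
  have \<kappa>: "0 < \<kappa> i j l t \<and> \<kappa> i j l t \<le> ?r" for i j l t
  proof -
    have "\<kappa>b i j l \<le> ?r" unfolding max_delay_def
      by (intro Max_ge finite_imageI finite_UNIV image_eqI[of _ _ "(i, j, l)"]) auto
    then show ?thesis using assms(1) unfolding delays_bounded_def by (meson order_trans)
  qed
  then have r: "0 \<le> ?r" by (meson less_le_trans less_imp_le)
  have apJ: "almost_periodic (J i)" for i using assms(2) unfolding cond_H1_def by auto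
  show "history u t \<in> basin ?r \<beta> \<alpha> \<Sigma>"
    unfolding basin_def basin_component_def history_def
  proof (intro CollectI allI conjI ballI)
    fix i
    have \<phi>i: "continuous_on {-?r..0} (\<lambda>s. \<phi> s $ i)"
      "\<And>s. s \<in> {-?r..0} \<Longrightarrow> if \<Sigma> i = 1 then \<phi> s $ i \<le> \<beta> i else \<alpha> i \<le> \<phi> s $ i"
      using \<phi> unfolding basin_def basin_component_def by auto
    have "continuous_on {-?r..0} (\<lambda>s. u s $ i)"
      using continuous_on_cong[THEN iffD1, OF refl _ \<phi>i(1)] sol unfolding gnn_solution_def by simp
    moreover have "continuous_on {0..} (\<lambda>s. u s $ i)"
      using sol unfolding gnn_solution_def continuous_on_eq_continuous_within
      by (blast intro: DERIV_continuous atLeast_iff[THEN iffD1])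
    \<comment> \<open>Initial data and differentiability give continuity on two closed pieces
      meeting at 0, which covers histories that straddle the initial time.\<close>
    ultimately have "continuous_on ({-?r..0} \<union> {0..}) (\<lambda>s. u s $ i)"
      by (intro continuous_on_closed_Un) auto
    then show "continuous_on {-?r..0} (\<lambda>s. u (t + s) $ i)"
      by (rule continuous_on_compose2[where f = "\<lambda>s. t + s"])
        (use \<open>0 \<le> t\<close> in \<open>auto intro: continuous_on_add\<close>)
    fix s assume s: "s \<in> {-?r..0}"
    then have ts: "- ?r \<le> t + s" using \<open>0 \<le> t\<close> by auto
    note inv = component_invariant[OF assms(2,3,4) _ \<kappa> sol _ _ _ _ ts]
    show "if \<Sigma> i = 1 then u (t + s) $ i \<le> \<beta> i else \<alpha> i \<le> u (t + s) $ i"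
    proof (cases "\<Sigma> i = 1")
      case True
      have "- \<beta> i \<le> - 1 * u (t + s) $ i"
      \<comment> \<open>With e = -1 the upper bound \<beta> becomes the lower bound -\<beta>, and
        negating the equation in \<open>lower_pt\<close> gives the balance at that level.\<close>
      proof (rule inv[where k = 1 and ?J0.0 = "- (SUP t. J i t)"])
        show "- 1 * crit_pt c a g \<sigma> i 1 < - \<beta> i"
          "- 1 * aux_F c a g \<sigma> i (- 1 * - \<beta> i) - cross_bound a B i + - (SUP t. J i t) = 0"
          using assms(6)[of i] unfolding lower_pt_def by auto
        show "- (SUP t. J i t) \<le> - 1 * J i t" for t
          using cSUP_upper[OF UNIV_I almost_periodic_bdd(1)[OF apJ]] by auto
        show "- \<beta> i \<le> - 1 * \<phi> s $ i" if "s \<in> {-?r..0}" for s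
          using \<phi>i(2)[OF that] True by auto
      qed auto
      then show ?thesis using True by simp
    next
      case False
      have "\<alpha> i \<le> 1 * u (t + s) $ i"
      proof (rule inv[where k = 2 and ?J0.0 = "INF t. J i t"])
        show "1 * crit_pt c a g \<sigma> i 2 < \<alpha> i"
          "1 * aux_F c a g \<sigma> i (1 * \<alpha> i) - cross_bound a B i + (INF t. J i t) = 0"
          using assms(7)[of i] unfolding upper_pt_def by auto
        show "(INF t. J i t) \<le> 1 * J i t" for t
          using cINF_lower[OF almost_periodic_bdd(2)[OF apJ] UNIV_I] by auto
        show "\<alpha> i \<le> 1 * \<phi> s $ i" if "s \<in> {-?r..0}" for s
          using \<phi>i(2)[OF that] False by auto
      qed auto
      then show ?thesis using False by simp
    qed
  qed
qed

end
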